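(* There do not exist edge-regular graphs $G_1$ and $G_2$ such that the tensor product $G_1\otimes G_2$ is a strongly regular graph with parameters $(99,14,1,2)$ (Conway's 99-graph). That is, if Conway's 99-graph exists, it cannot be constructed as the tensor product of edge-regular graphs.
   Context: A graph is edge-regular, $G\in ER(n,d,\lambda)$, if it has $n$ vertices, is regular of degree $d$, and every pair of adjacent vertices has exactly $\lambda$ common neighbors. A strongly regular graph with parameters $(n,d,\lambda,\mu)$ is a graph in $ER(n,d,\lambda)$ in which every pair of distinct non-adjacent vertices has exactly $\mu$ common neighbors. The tensor product $G_1\otimes G_2$ has vertex set $V(G_1)\times V(G_2)$, with $(u,u')\sim(v,v')$ iff $u\sim v$ in $G_1$ and $u'\sim v'$ in $G_2$. *)

theory Defs
  imports "Graph_Theory.Pair_Digraph"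
begin

text \<open>
  Finite simple graphs are rendered by the locale \<^locale>\<open>pair_graph\<close>: a finite vertex set with a
  symmetric, loop-free set of arcs, where \<^term>\<open>(u, v) \<in> parcs G\<close> means that u and v are adjacent.
  Each edge is present in both directions, so the degree of a vertex is its \<^const>\<open>out_degree\<close>.
\<close>

definition common_neighbors :: "'a pair_pre_digraph \<Rightarrow> 'a \<Rightarrow> 'a \<Rightarrow> 'a set" where
  "common_neighbors G u v = {w \<in> pverts G. (u, w) \<in> parcs G \<and> (v, w) \<in> parcs G}"

definition edge_regular :: "'a pair_pre_digraph \<Rightarrow> nat \<Rightarrow> nat \<Rightarrow> nat \<Rightarrow> bool" where
  "edge_regular G n d l \<longleftrightarrow>
     pair_graph G \<and>
     card (pverts G) = n \<and>
     (\<forall>v \<in> pverts G. out_degree (with_proj G) v = d) \<and>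
     (\<forall>u \<in> pverts G. \<forall>v \<in> pverts G. (u, v) \<in> parcs G \<longrightarrow> card (common_neighbors G u v) = l)"

definition strongly_regular :: "'a pair_pre_digraph \<Rightarrow> nat \<Rightarrow> nat \<Rightarrow> nat \<Rightarrow> nat \<Rightarrow> bool" where
  "strongly_regular G n d l m \<longleftrightarrow>
     edge_regular G n d l \<and>
     (\<forall>u \<in> pverts G. \<forall>v \<in> pverts G.
        u \<noteq> v \<and> (u, v) \<notin> parcs G \<longrightarrow> card (common_neighbors G u v) = m)"

definition tensor_product ::
  "'a pair_pre_digraph \<Rightarrow> 'b pair_pre_digraph \<Rightarrow> ('a \<times> 'b) pair_pre_digraph" where
  "tensor_product G H =
     \<lparr> pverts = pverts G \<times> pverts H,
       parcs = {((u, u'), (v, v')) | u u' v v'. (u, v) \<in> parcs G \<and> (u', v') \<in> parcs H} \<rparr>"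

end

theory Submission
  imports Defs
begin

text \<open>
  Common neighborhoods in a tensor product are products of common neighborhoods in the factors.
  As there are no loops, (u, u') and (u, v') are distinct and non-adjacent whenever u' and v' are
  adjacent, and counting their common neighbors gives \<open>d1 * l2 = 2\<close>; symmetrically
  \<open>l1 * d2 = 2\<close>. Hence both degrees are at most 2, contradicting \<open>d1 * d2 = 14\<close>.
\<close>

lemma common_neighbors_tensor_product:
  "common_neighbors (tensor_product G H) (u, u') (v, v') =
     common_neighbors G u v \<times> common_neighbors H u' v'"
  by (auto simp: common_neighbors_def tensor_product_def)

text \<open>On the diagonal, common neighbors are just neighbors. Degrees thus become an instance of
  common-neighbor counts, and the product formula covers both.\<close>

lemma out_degree_eq_card_common_neighbors:
  assumes "pair_graph G"
  shows "out_degree (with_proj G) v = card (common_neighbors G v v)"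
proof -
  interpret pair_graph G by fact
  \<comment> \<open>Arcs are pairs, so those leaving \<open>v\<close> correspond injectively to
    their heads; \<open>in_arcsD2\<close> places the heads in \<open>pverts G\<close>.\<close>
  have "out_arcs (with_proj G) v = Pair v ` common_neighbors G v v"
    by (auto simp: out_arcs_def common_neighbors_def dest: in_arcsD2)
  then show ?thesis
    by (simp add: out_degree_def card_image inj_on_def)
qed

lemma edge_regularD:
  assumes "edge_regular G n d l"
  shows "v \<in> pverts G \<Longrightarrow> card (common_neighbors G v v) = d"
    and "(u, v) \<in> parcs G \<Longrightarrow> u \<in> pverts G \<and> v \<in> pverts G \<and> u \<noteq> v"
    and "(u, v) \<in> parcs G \<Longrightarrow> card (common_neighbors G u v) = l"
    and "(v, v) \<notin> parcs G"
proof -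
  interpret pair_graph G using assms by (simp add: edge_regular_def)
  show "v \<in> pverts G \<Longrightarrow> card (common_neighbors G v v) = d"
    using assms out_degree_eq_card_common_neighbors[of G v] by (simp add: edge_regular_def)
  show *: "(u, v) \<in> parcs G \<Longrightarrow> u \<in> pverts G \<and> v \<in> pverts G \<and> u \<noteq> v" for u v
    using in_arcsD1 in_arcsD2 no_loops' by blast
  then show "(u, v) \<in> parcs G \<Longrightarrow> card (common_neighbors G u v) = l"
    using assms by (simp add: edge_regular_def)
  show "(v, v) \<notin> parcs G"
    using * by blast
qed

text \<open>Positive \<open>n\<close> yields a vertex and positive \<open>d\<close> an edge in each
  factor. The edges matter: in an edgeless graph \<open>edge_regular\<close> holds vacuously for
  every \<open>l\<close>.\<close>

lemma strongly_regular_tensor_product_parameters: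
  assumes G: "edge_regular G n1 d1 l1" and H: "edge_regular H n2 d2 l2"
    and T: "strongly_regular (tensor_product G H) n d l m"
    and "n > 0" "d > 0"
  shows "d1 * d2 = d" "d1 * l2 = m" "l1 * d2 = m"
proof -
  let ?T = "tensor_product G H"
  have T': "edge_regular ?T n d l"
    using T by (simp add: strongly_regular_def)
  have verts: "pverts ?T = pverts G \<times> pverts H"
    by (simp add: tensor_product_def)
  have "card (pverts ?T) = n"
    using T' by (simp add: edge_regular_def)
  with \<open>n > 0\<close> have "pverts ?T \<noteq> {}" by auto
  then obtain u u' where u: "u \<in> pverts G" and u': "u' \<in> pverts H"
    by (auto simp: verts)
  have "card (common_neighbors ?T (u, u') (u, u')) = d"
    using edge_regularD(1)[OF T'] u u' by (simp add: verts)
  then show d: "d1 * d2 = d"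
    using edge_regularD(1)[OF G u] edge_regularD(1)[OF H u']
    by (simp add: common_neighbors_tensor_product card_cartesian_product)
  have nonadj: "card (common_neighbors ?T x y) = m"
    if "x \<in> pverts ?T" "y \<in> pverts ?T" "x \<noteq> y" "(x, y) \<notin> parcs ?T" for x y
    using T that by (simp add: strongly_regular_def)
  \<comment> \<open>Since \<open>d1 * d2 = d > 0\<close>, neither degree vanishes, so
    \<open>u\<close> and \<open>u'\<close> each have a neighbor.\<close>
  have "common_neighbors G u u \<noteq> {}" "common_neighbors H u' u' \<noteq> {}"
    using edge_regularD(1)[OF G u] edge_regularD(1)[OF H u'] d \<open>d > 0\<close> by auto
  then obtain v v' where v: "(u, v) \<in> parcs G" and v': "(u', v') \<in> parcs H"
    by (auto simp: common_neighbors_def)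
  \<comment> \<open>The repeated coordinate \<open>u\<close> contributes its whole neighborhood,
    hence the factor \<open>d1\<close>.\<close>
  have "card (common_neighbors ?T (u, u') (u, v')) = m"
    using edge_regularD(2)[OF H v'] edge_regularD(4)[OF G] u
    by (intro nonadj) (auto simp: tensor_product_def)
  then show "d1 * l2 = m"
    using edge_regularD(1)[OF G u] edge_regularD(3)[OF H v']
    by (simp add: common_neighbors_tensor_product card_cartesian_product)
  have "card (common_neighbors ?T (u, u') (v, u')) = m"
    using edge_regularD(2)[OF G v] edge_regularD(4)[OF H] u'
    by (intro nonadj) (auto simp: tensor_product_def)
  then show "l1 * d2 = m"
    using edge_regularD(3)[OF G v] edge_regularD(1)[OF H u']
    by (simp add: common_neighbors_tensor_product card_cartesian_product)
qed

theorem theorem12: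
  shows "\<not> (\<exists>(G1 :: 'a pair_pre_digraph) (G2 :: 'b pair_pre_digraph).
            (\<exists>n1 d1 l1. edge_regular G1 n1 d1 l1) \<and>
            (\<exists>n2 d2 l2. edge_regular G2 n2 d2 l2) \<and>
            strongly_regular (tensor_product G1 G2) 99 14 1 2)"
proof
  assume "\<exists>(G1 :: 'a pair_pre_digraph) (G2 :: 'b pair_pre_digraph).
            (\<exists>n1 d1 l1. edge_regular G1 n1 d1 l1) \<and>
            (\<exists>n2 d2 l2. edge_regular G2 n2 d2 l2) \<and>
            strongly_regular (tensor_product G1 G2) 99 14 1 2"
  then obtain G1 :: "'a pair_pre_digraph" and G2 :: "'b pair_pre_digraph"
    and n1 d1 l1 n2 d2 l2
    where "edge_regular G1 n1 d1 l1" "edge_regular G2 n2 d2 l2"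
      and "strongly_regular (tensor_product G1 G2) 99 14 1 2"
    by blast
  from strongly_regular_tensor_product_parameters[OF this]
  have d: "d1 * d2 = 14" and "d1 * l2 = 2" "l1 * d2 = 2"
    by simp_all
  \<comment> \<open>Divisors of the nonzero number 2 are at most 2, so no separate case for a zero
    \<open>l1\<close> or \<open>l2\<close> arises.\<close>
  then have "d1 dvd 2" "d2 dvd 2"
    by (metis dvd_triv_left, metis dvd_triv_right)
  then have "d1 \<le> 2" "d2 \<le> 2"
    by (simp_all add: dvd_imp_le)
  then have "d1 * d2 \<le> 2 * 2"
    by (rule mult_le_mono)
  with d show False by simp
qed

end
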